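(* Let $D\subset\mathbb{R}^2$ be a bounded strictly convex domain with smooth boundary, let $O$ be a nonempty open strictly convex set with smooth boundary and $\bar O\subset D$, and let $\Omega=D\setminus\bar O$. Let the set of tomography be the outer boundary $E=\partial D$ and let the reflecting part of the boundary be the inner boundary $R=\partial O$. If $f\in C^2(\bar\Omega)$ is a real-valued function whose broken ray transform vanishes, then $f=0$.
   Context: The boundary $\partial\Omega$ is the disjoint union of $E$ and $R$. A broken ray is a unit speed curve $\gamma:[0,L]\to\bar\Omega$ of finite length $L$ which is a straight line (geodesic) in the interior of $\Omega$, has both endpoints on $E$, and reflects at other boundary points according to the usual reflection law: at a reflection point with outer unit normal $\nu$, the incoming direction $v_i$ and outgoing direction $v_o$ satisfy $v_o=v_i-2\langle\nu,v_i\rangle\nu$. A broken ray must reflect whenever it hits $R$; when it hits $E$ it may either reflect or stop. Tangential reflections are allowed, in which case the direction does not change. The broken ray transform of a continuous function $f$ is the function on the set of all broken rays given by $\gamma\mapsto\int_0^L f(\gamma(t))\,\mathrm{d}t$; it vanishes if all these integrals are zero. *)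

theory Defs
  imports "HOL-Analysis.Analysis"
begin

text \<open>
  \<^term>\<open>Ck_fun k U A f\<close>, for open \<open>U\<close> and \<open>U \<subseteq> A \<subseteq> closure U\<close>: \<open>f\<close> is \<open>k\<close> times differentiable in \<open>U\<close>
  and its partial derivatives of order at most \<open>k\<close> extend continuously to \<open>A\<close>
  (\<open>G b\<close> is the extension of the partial derivative in direction \<open>b\<close>).
  Hence \<open>A = U\<close> gives \<open>C\<^sup>k(U)\<close> and \<open>A = closure U\<close> gives \<open>C\<^sup>k(closure U)\<close>.
\<close>

primrec Ck_fun ::
  "nat \<Rightarrow> 'a::euclidean_space set \<Rightarrow> 'a set \<Rightarrow> ('a \<Rightarrow> real) \<Rightarrow> bool" where
  "Ck_fun 0 U A f \<longleftrightarrow> continuous_on A f"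
| "Ck_fun (Suc k) U A f \<longleftrightarrow> continuous_on A f \<and>
     (\<exists>G. (\<forall>x\<in>U. (f has_derivative (\<lambda>v. \<Sum>b\<in>Basis. (v \<bullet> b) * G b x)) (at x)) \<and>
          (\<forall>b\<in>Basis. Ck_fun k U A (G b)))"

definition Ck_closure :: "nat \<Rightarrow> 'a::euclidean_space set \<Rightarrow> ('a \<Rightarrow> real) \<Rightarrow> bool" where
  "Ck_closure k U f \<longleftrightarrow> Ck_fun k U (closure U) f"

definition smooth_fun :: "'a::euclidean_space set \<Rightarrow> ('a \<Rightarrow> real) \<Rightarrow> bool" where
  "smooth_fun U f \<longleftrightarrow> (\<forall>k. Ck_fun k U U f)"

definition local_defining_function ::
  "'a::euclidean_space set \<Rightarrow> 'a \<Rightarrow> 'a set \<Rightarrow> ('a \<Rightarrow> real) \<Rightarrow> bool" where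
  "local_defining_function S p U \<rho> \<longleftrightarrow>
     open U \<and> p \<in> U \<and> smooth_fun U \<rho> \<and>
     (\<forall>x\<in>U. \<exists>g. GDERIV \<rho> x :> g \<and> g \<noteq> 0) \<and>
     S \<inter> U = {x\<in>U. \<rho> x < 0}"

definition smooth_boundary :: "'a::euclidean_space set \<Rightarrow> bool" where
  "smooth_boundary S \<longleftrightarrow> (\<forall>p\<in>frontier S. \<exists>U \<rho>. local_defining_function S p U \<rho>)"

definition outer_unit_normal :: "'a::euclidean_space set \<Rightarrow> 'a \<Rightarrow> 'a \<Rightarrow> bool" where
  "outer_unit_normal S p \<nu> \<longleftrightarrow>
     p \<in> frontier S \<and>
     (\<exists>U \<rho> g. local_defining_function S p U \<rho> \<and> GDERIV \<rho> p :> g \<and> \<nu> = g /\<^sub>R norm g)"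

text \<open>
  The points range over the closure: for open \<open>S\<close>, letting them range over \<open>S\<close> only
  would give plain convexity.
\<close>

definition strictly_convex :: "'a::euclidean_space set \<Rightarrow> bool" where
  "strictly_convex S \<longleftrightarrow>
     (\<forall>x\<in>closure S. \<forall>y\<in>closure S. x \<noteq> y \<longrightarrow> open_segment x y \<subseteq> interior S)"

definition straight_at :: "real \<Rightarrow> (real \<Rightarrow> 'a::euclidean_space) \<Rightarrow> real \<Rightarrow> bool" where
  "straight_at L \<gamma> t \<longleftrightarrow>
     (\<exists>v \<epsilon>. norm v = 1 \<and> \<epsilon> > 0 \<and>
        (\<forall>s\<in>{0..L}. \<bar>s - t\<bar> < \<epsilon> \<longrightarrow> \<gamma> s = \<gamma> t + (s - t) *\<^sub>R v))"

definition reflects_at ::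
  "'a::euclidean_space set \<Rightarrow> real \<Rightarrow> (real \<Rightarrow> 'a) \<Rightarrow> real \<Rightarrow> bool" where
  "reflects_at \<Omega> L \<gamma> t \<longleftrightarrow>
     (\<exists>v_in v_out \<nu>.
        (\<gamma> has_vector_derivative v_in) (at t within {0..t}) \<and>
        (\<gamma> has_vector_derivative v_out) (at t within {t..L}) \<and>
        outer_unit_normal \<Omega> (\<gamma> t) \<nu> \<and>
        v_out = v_in - (2 * (\<nu> \<bullet> v_in)) *\<^sub>R \<nu>)"

text \<open>
  A boundary time strictly between \<open>0\<close> and \<open>L\<close> is one where the ray does not stop, so it reflects
  there, on \<open>E\<close> as well as on \<open>R\<close>; tangential reflections are the case \<open>v_out = v_in\<close>.
  A broken ray meets the boundary only finitely often. Without this requirement a curve gliding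
  along the boundary would satisfy the reflection law at each of its points.
\<close>

definition broken_ray ::
  "'a::euclidean_space set \<Rightarrow> 'a set \<Rightarrow> 'a set \<Rightarrow> real \<Rightarrow> (real \<Rightarrow> 'a) \<Rightarrow> bool" where
  "broken_ray \<Omega> E R L \<gamma> \<longleftrightarrow>
     0 < L \<and> continuous_on {0..L} \<gamma> \<and> \<gamma> ` {0..L} \<subseteq> closure \<Omega> \<and>
     \<gamma> 0 \<in> E \<and> \<gamma> L \<in> E \<and>
     finite {t\<in>{0..L}. \<gamma> t \<in> frontier \<Omega>} \<and>
     (\<forall>t\<in>{0..L}. \<gamma> t \<in> \<Omega> \<longrightarrow> straight_at L \<gamma> t) \<and>
     (\<forall>t\<in>{0<..<L}. \<gamma> t \<in> E \<union> R \<longrightarrow> reflects_at \<Omega> L \<gamma> t)"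

definition broken_ray_transform ::
  "('a::euclidean_space \<Rightarrow> real) \<Rightarrow> real \<Rightarrow> (real \<Rightarrow> 'a) \<Rightarrow> real" where
  "broken_ray_transform f L \<gamma> = integral {0..L} (\<lambda>t. f (\<gamma> t))"

definition broken_ray_transform_vanishes ::
  "'a::euclidean_space set \<Rightarrow> 'a set \<Rightarrow> 'a set \<Rightarrow> ('a \<Rightarrow> real) \<Rightarrow> bool" where
  "broken_ray_transform_vanishes \<Omega> E R f \<longleftrightarrow>
     (\<forall>L \<gamma>. broken_ray \<Omega> E R L \<gamma> \<longrightarrow> broken_ray_transform f L \<gamma> = 0)"

end

theory Submission
  imports Defs
begin

text \<open>
  Reflections are not needed: already the chords of \<open>D\<close> that miss the obstacle determine
  the function outside it, as in Helgason's support theorem. Extend \<open>f\<close> by zero to \<open>g\<close>. If \<open>t \<mapsto> t\<^sup>k g\<close>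
  integrates to zero over all lines that miss the obstacle, then so does \<open>t \<mapsto> t\<^bsup>k+1\<^esup> g\<close>: integrate
  over all parallel translates of the line \<open>s = t a\<close> on the far side from the obstacle and
  differentiate in the slope \<open>a\<close> at \<open>0\<close>. Hence all moments of \<open>g\<close> along such a line vanish, and by
  Weierstrass \<open>g\<close> vanishes on it. Since the obstacle is convex, every point outside its closure lies on such a line.
\<close>

section \<open>Tail integrals in one variable\<close>

lemma integrable_bounded_support:
  fixes \<phi> :: "real \<Rightarrow> real"
  assumes [measurable]: "\<phi> \<in> borel_measurable borel"
    and B: "\<And>s. \<bar>s\<bar> \<le> T \<Longrightarrow> \<bar>\<phi> s\<bar> \<le> B" and supp: "\<And>s. \<phi> s \<noteq> 0 \<Longrightarrow> \<bar>s\<bar> \<le> T"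
  shows "integrable lborel \<phi>"
proof (rule Bochner_Integration.integrable_bound)
  show "integrable lborel (\<lambda>s. \<bar>B\<bar> * indicator {-T..T} s)"
    by (intro integrable_mult_right integrable_real_indicator emeasure_bounded_finite) auto
  have "\<bar>\<phi> s\<bar> \<le> \<bar>B\<bar> * indicator {-T..T} s" for s
    using B[of s] supp[of s] by (cases "\<phi> s = 0") (auto simp: indicator_def abs_le_iff)
  thus "AE s in lborel. norm (\<phi> s) \<le> norm (\<bar>B\<bar> * indicator {-T..T} s)"
    by (intro AE_I2) (simp add: abs_mult)
qed simp

text \<open>For \<open>x\<close> in (-1,1) the tail is a constant minus the integral over [-1,x], so
  the fundamental theorem of calculus applies at 0. Its pointwise form, with continuity at 0 alone,
  is what the application requires: the zero extension of \<open>f\<close> may jump at the outer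
  boundary.\<close>

lemma tail_integral_has_derivative:
  fixes \<phi> :: "real \<Rightarrow> real"
  assumes \<phi>: "integrable lborel \<phi>" and cont: "isCont \<phi> 0"
  shows "((\<lambda>x. LINT s|lborel. (if x < s then \<phi> s else 0)) has_real_derivative - \<phi> 0) (at 0)"
proof -
  have [measurable]: "\<phi> \<in> borel_measurable borel"
    using borel_measurable_integrable[OF \<phi>] by simp
  have int: "set_integrable lborel {-1..1} \<phi>"
    unfolding set_integrable_def using integrable_mult_indicator[OF _ \<phi>] by auto
  have "((\<lambda>u. integral {-1..u} \<phi>) has_vector_derivative \<phi> 0) (at 0 within ({-1..1} - {}))"
    using set_borel_integral_eq_integral(1)[OF int] cont
    by (intro integral_has_vector_derivative_continuous_at) (auto intro: continuous_at_imp_continuous_at_within)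
  moreover have "at 0 within {-1..1::real} = at 0"
    by (rule at_within_interior) simp
  ultimately have "((\<lambda>u. integral {-1..u} \<phi>) has_real_derivative \<phi> 0) (at 0)"
    by (simp add: has_real_derivative_iff_has_vector_derivative)
  hence der: "((\<lambda>u. (LINT s|lborel. indicator {-1..} s * \<phi> s) - integral {-1..u} \<phi>) has_real_derivative 0 - \<phi> 0) (at 0)"
    by (intro DERIV_diff DERIV_const)
  have eq: "(LINT s|lborel. indicator {-1..} s * \<phi> s) - integral {-1..u} \<phi> = (LINT s|lborel. (if u < s then \<phi> s else 0))"
    if u: "u \<in> {-1<..<1}" for u
  proof -
    have i1: "integrable lborel (\<lambda>s. indicator {-1..u} s * \<phi> s)" 
      and i2: "integrable lborel (\<lambda>s. indicator {u<..} s * \<phi> s)"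
      using integrable_mult_indicator[OF _ \<phi>] by auto
    have "(\<lambda>s. indicator {-1..} s * \<phi> s) = (\<lambda>s. indicator {-1..u} s * \<phi> s + indicator {u<..} s * \<phi> s)"
      using u by (auto simp: indicator_def fun_eq_iff)
    hence "(LINT s|lborel. indicator {-1..} s * \<phi> s) =
      (LINT s|lborel. indicator {-1..u} s * \<phi> s) + (LINT s|lborel. indicator {u<..} s * \<phi> s)"
      using i1 i2 by simp
    moreover have "(LINT s|lborel. indicator {-1..u} s * \<phi> s) = integral {-1..u} \<phi>"
      using set_borel_integral_eq_integral(2)[of "{-1..u}" \<phi>] i1
      by (simp add: set_integrable_def set_lebesgue_integral_def)
    moreover have "(\<lambda>s. indicator {u<..} s * \<phi> s) = (\<lambda>s. (if u < s then \<phi> s else 0))"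
      by (auto simp: fun_eq_iff)
    ultimately show ?thesis by simp
  qed
  have "((\<lambda>x. LINT s|lborel. (if x < s then \<phi> s else 0)) has_real_derivative 0 - \<phi> 0) (at 0)"
    by (rule has_field_derivative_transform_within_open[OF der, of "{-1<..<1}"]) (use eq in auto)
  thus ?thesis by simp
qed

text \<open>The two tails differ only between \<open>x\<close> and \<open>y\<close>, where the
  integrand is at most \<open>B\<close>. This estimate dominates the difference quotients when the
  tail is differentiated under another integral.\<close>

lemma tail_integral_lipschitz:
  fixes \<phi> :: "real \<Rightarrow> real"
  assumes \<phi>: "integrable lborel \<phi>" and B: "\<And>s. \<bar>\<phi> s\<bar> \<le> B"
  shows "\<bar>(LINT s|lborel. (if x < s then \<phi> s else 0)) - (LINT s|lborel. (if y < s then \<phi> s else 0))\<bar> \<le> B * \<bar>y - x\<bar>"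
proof -
  have [measurable]: "\<phi> \<in> borel_measurable borel"
    using borel_measurable_integrable[OF \<phi>] by simp
  have i: "integrable lborel (\<lambda>s. (if u < s then \<phi> s else 0))" for u
    by (rule Bochner_Integration.integrable_bound[OF \<phi>]) auto
  have "(LINT s|lborel. (if x < s then \<phi> s else 0)) - (LINT s|lborel. (if y < s then \<phi> s else 0))
     = (LINT s|lborel. (if x < s then \<phi> s else 0) - (if y < s then \<phi> s else 0))"
    using i by simp
  also have "norm \<dots> \<le> (LINT s|lborel. B * indicator {min x y..max x y} s)"
  proof (rule Bochner_Integration.integral_norm_bound_integral)
    show "integrable lborel (\<lambda>s. B * indicator {min x y..max x y} s)" by simp
  qed (use i B order_trans[OF abs_ge_zero B] in \<open>auto simp: indicator_def\<close>)
  also have "\<dots> = B * \<bar>y - x\<bar>" by auto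
  finally show ?thesis by simp
qed

section \<open>Vanishing of all moments along lines that miss the obstacle\<close>

text \<open>Summing the hypothesis over all heights \<open>b > 0\<close> at a fixed slope
  \<open>a\<close> gives that the integral of t^k A(t, ta) vanishes, where A(t, x) is the tail of
  \<open>G t\<close> beyond x. Since A(t, ta) has derivative -t G(t, 0) in \<open>a\<close> at 0,
  differentiating produces the extra factor t. Slopes are available on one side only, so the
  derivative is taken along a positive null sequence.\<close>

lemma moment_step_plane:
  fixes G :: "real \<Rightarrow> real \<Rightarrow> real"
  assumes meas: "case_prod G \<in> borel_measurable borel"
    and B: "\<And>t s. \<bar>G t s\<bar> \<le> B"
    and supp: "\<And>t s. G t s \<noteq> 0 \<Longrightarrow> \<bar>t\<bar> \<le> T \<and> \<bar>s\<bar> \<le> T"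
    and "0 < \<epsilon>"
    and zero: "\<And>a b. 0 \<le> a \<Longrightarrow> a < \<epsilon> \<Longrightarrow> 0 \<le> b \<Longrightarrow> (LINT t|lborel. t ^ k * G t (b + t * a)) = 0"
    and cont: "AE t in lborel. isCont (G t) 0"
  shows "(LINT t|lborel. t ^ Suc k * G t 0) = 0"
proof -
  have meas'[measurable]: "case_prod G \<in> borel_measurable (borel \<Otimes>\<^sub>M borel)"
    using meas by (simp add: borel_prod)
  have B0: "0 \<le> B" using order_trans[OF abs_ge_zero B] .
  have G_int: "integrable lborel (G t)" for t
    by (rule integrable_bounded_support[where B = B and T = T]) (use supp B in auto)
  define A where "A t x = (LINT s|lborel. (if x < s then G t s else 0))" for t x
  have A_meas: "(\<lambda>t. A t (t * a)) \<in> borel_measurable borel" for a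
    unfolding A_def by measurable
  have A_zero: "A t x = 0" if "T < \<bar>t\<bar>" for t x
  proof -
    have "(\<lambda>s. (if x < s then G t s else 0)) = (\<lambda>s. 0)" using supp that by fastforce
    thus ?thesis by (simp add: A_def)
  qed
  have A_eq: "A t (t * a) = (LINT s|lborel. (if 0 < s then G t (s + t * a) else 0))" for t a
    unfolding A_def
    by (subst lborel_integral_real_affine[where c=1 and t="t*a"]) (auto intro!: Bochner_Integration.integral_cong simp: add.commute)
  \<comment> \<open>Fubini: integrating in \<open>t\<close> first gives 0 for every height
    \<open>s > 0\<close> by \<open>zero\<close>; integrating in \<open>s\<close> first gives the
    tail \<open>A\<close>.\<close>
  have fub: "(LINT t|lborel. t ^ k * A t (t * a)) = 0" if a: "0 \<le> a" "a < \<epsilon>" for a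
  proof -
    define H where "H t s = (if 0 < s then t ^ k * G t (s + t * a) else 0)" for t s :: real
    have H_meas[measurable]: "case_prod H \<in> borel_measurable (borel \<Otimes>\<^sub>M borel)"
      unfolding H_def by measurable
    \<comment> \<open>The shear (t, s) to (t, s + ta) moves points of the support by at most T a in
      height, so \<open>H\<close> lives in the box with half-height T + T a.\<close>
    define C where "C = T * (1 + a)"
    have "integrable (lborel \<Otimes>\<^sub>M lborel) (case_prod H)"
    proof (rule integrableI_bounded_set[of "{-T..T} \<times> {-C..C}" _ _ "\<bar>T\<bar> ^ k * B"])
      show "{-T..T} \<times> {-C..C} \<in> sets (lborel \<Otimes>\<^sub>M lborel)" by auto
      show "case_prod H \<in> borel_measurable (lborel \<Otimes>\<^sub>M lborel)"
        using H_meas by (simp cong: measurable_cong_sets)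
      have "{-T..T} \<times> {-C..C} = cbox (-T,-C) (T,C)" by (auto simp: cbox_Pair_eq)
      thus "emeasure (lborel \<Otimes>\<^sub>M lborel) ({-T..T} \<times> {-C..C}) < \<infinity>"
        by (simp add: lborel_prod emeasure_lborel_cbox_eq)
      have "\<bar>H t s\<bar> \<le> \<bar>T\<bar> ^ k * B" if "\<bar>t\<bar> \<le> T" for t s
        unfolding H_def using that B B0
        by (auto simp: abs_mult power_abs intro!: mult_mono power_mono)
      thus "AE x in lborel \<Otimes>\<^sub>M lborel. x \<in> {-T..T} \<times> {-C..C} \<longrightarrow> norm (case_prod H x) \<le> \<bar>T\<bar> ^ k * B"
        by (auto intro!: AE_I2)
      have "\<bar>t\<bar> \<le> T \<and> \<bar>s\<bar> \<le> C" if "H t s \<noteq> 0" for t s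
      proof -
        have "G t (s + t * a) \<noteq> 0" using that by (auto simp: H_def split: if_splits)
        hence *: "\<bar>t\<bar> \<le> T" "\<bar>s + t * a\<bar> \<le> T" using supp by auto
        have "\<bar>t * a\<bar> \<le> T * a" using * a by (auto simp: abs_mult intro: mult_right_mono)
        thus ?thesis using * by (auto simp: C_def algebra_simps)
      qed
      thus "AE x in lborel \<Otimes>\<^sub>M lborel. x \<notin> {-T..T} \<times> {-C..C} \<longrightarrow> case_prod H x = 0"
        by (intro AE_I2) (force simp: abs_le_iff)
    qed
    hence "(LINT s|lborel. LINT t|lborel. H t s) = (LINT t|lborel. LINT s|lborel. H t s)"
      by (rule lborel_pair.Fubini_integral)
    moreover have "(LINT t|lborel. H t s) = 0" for s
      using zero[OF a, of s] by (cases "0 < s") (simp_all add: H_def)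
    moreover have "(LINT s|lborel. H t s) = t ^ k * A t (t * a)" for t
    proof -
      have "H t = (\<lambda>s. t ^ k * (if 0 < s then G t (s + t * a) else 0))"
        by (auto simp: H_def)
      thus ?thesis by (simp add: A_eq)
    qed
    ultimately show ?thesis by simp
  qed
  \<comment> \<open>The double successor keeps already the first slope, half of
    \<open>\<epsilon>\<close>, strictly below \<open>\<epsilon>\<close>.\<close>
  define a where "a n = \<epsilon> * inverse (real (Suc (Suc n)))" for n
  have a: "0 < a n" "a n < \<epsilon>" for n
    using \<open>0 < \<epsilon>\<close> by (auto simp: a_def field_simps add_pos_nonneg)
  have a_lim: "a \<longlonglongrightarrow> 0" unfolding a_def
    by (intro tendsto_mult_right_zero LIMSEQ_Suc LIMSEQ_inverse_real_of_nat)
  \<comment> \<open>This is t^k times the negated difference quotient of A(t, ta) in the slope. Each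
    \<open>S n\<close> integrates to 0 by \<open>fub\<close>, while the pointwise limit is t^(k+1)
    G(t, 0).\<close>
  define S where "S n t = t ^ k * A t 0 / a n - t ^ k * A t (t * a n) / a n" for n t
  \<comment> \<open>The Lipschitz bound B |t| \<open>a n\<close> for the increment cancels the
    denominator \<open>a n\<close>, which leaves a bound independent of \<open>n\<close>.\<close>
  define w where "w t = indicator {-T..T} t * (\<bar>T\<bar> ^ k * (B * \<bar>T\<bar>))" for t :: real
  have S_le: "\<bar>S n t\<bar> \<le> w t" for n t
  proof (cases "\<bar>t\<bar> \<le> T")
    case True
    have "S n t = t ^ k * (A t 0 - A t (t * a n)) / a n" by (simp add: S_def algebra_simps diff_divide_distrib)
    hence "\<bar>S n t\<bar> = \<bar>t\<bar> ^ k * \<bar>A t 0 - A t (t * a n)\<bar> / a n"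
      using a(1)[of n] by (simp add: abs_mult power_abs)
    also have "\<dots> \<le> \<bar>t\<bar> ^ k * (B * \<bar>t * a n - 0\<bar>) / a n"
      using a(1)[of n] unfolding A_def
      by (intro divide_right_mono mult_left_mono tail_integral_lipschitz[OF G_int B]) auto
    also have "\<dots> = \<bar>t\<bar> ^ k * (B * \<bar>t\<bar>)" using a(1)[of n] by (simp add: abs_mult)
    also have "\<dots> \<le> \<bar>T\<bar> ^ k * (B * \<bar>T\<bar>)"
      using True B0 by (intro mult_mono power_mono) auto
    finally show ?thesis using True by (simp add: w_def indicator_def abs_le_iff)
  next
    case False
    thus ?thesis using B0 by (simp add: S_def A_zero w_def)
  qed
  have A_int: "integrable lborel (\<lambda>t. t ^ k * A t (t * c))" for c
  proof (rule integrable_bounded_support[where T = T])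
    \<comment> \<open>Nothing of the support lies above height \<open>T\<close>, so comparing any
      tail with the one at \<open>T\<close> turns the Lipschitz estimate into a bound for
      \<open>A\<close> itself.\<close>
    have "A t T = 0" for t 
    proof -
      have "(\<lambda>s. (if T < s then G t s else 0)) = (\<lambda>s. 0)" using supp by fastforce
      thus ?thesis by (simp add: A_def)
    qed
    moreover have "\<bar>A t T - A t (t * c)\<bar> \<le> B * (2 * (T + \<bar>T * c\<bar>))" if "\<bar>t\<bar> \<le> T" for t
    proof -
      have "\<bar>A t T - A t (t * c)\<bar> \<le> B * \<bar>t * c - T\<bar>"
        unfolding A_def by (rule tail_integral_lipschitz[OF G_int B])
      also have "\<bar>t * c\<bar> \<le> \<bar>T * c\<bar>" using that by (auto simp: abs_mult intro!: mult_right_mono)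
      hence "B * \<bar>t * c - T\<bar> \<le> B * (2 * (T + \<bar>T * c\<bar>))" using that B0 by (intro mult_left_mono) auto
      finally show ?thesis .
    qed
    ultimately have "\<bar>t ^ k * A t (t * c)\<bar> \<le> \<bar>T\<bar> ^ k * (B * (2 * (T + \<bar>T * c\<bar>)))" if "\<bar>t\<bar> \<le> T" for t
      using that by (auto simp: abs_mult power_abs intro!: mult_mono power_mono)
    thus "\<And>t. \<bar>t\<bar> \<le> T \<Longrightarrow> \<bar>t ^ k * A t (t * c)\<bar> \<le> \<bar>T\<bar> ^ k * (B * (2 * (T + \<bar>T * c\<bar>)))" .
    show "\<bar>t\<bar> \<le> T" if "t ^ k * A t (t * c) \<noteq> 0" for t
      using A_zero[of t "t * c"] that by (cases "T < \<bar>t\<bar>") auto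
  qed (use A_meas in auto)
  have lim: "(\<lambda>n. LINT t|lborel. S n t) \<longlonglongrightarrow> (LINT t|lborel. t ^ Suc k * G t 0)"
  proof (rule integral_dominated_convergence[where w = w])
    show "(\<lambda>t. t ^ Suc k * G t 0) \<in> borel_measurable lborel" by measurable
    show "S n \<in> borel_measurable lborel" for n
      unfolding S_def using A_meas A_meas[of 0] by simp
    show "integrable lborel w" unfolding w_def
      by (intro integrable_mult_left integrable_real_indicator emeasure_bounded_finite) auto
    show "AE t in lborel. norm (S n t) \<le> w t" for n using S_le by (intro AE_I2) simp
    show "AE t in lborel. (\<lambda>n. S n t) \<longlonglongrightarrow> t ^ Suc k * G t 0"
      using cont
    proof eventually_elim
      case (elim t)
      have "(A t has_real_derivative - G t 0) (at (t * 0))"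
        unfolding A_def using tail_integral_has_derivative[OF G_int elim] by simp
      moreover have "((\<lambda>x. t * x) has_real_derivative t) (at 0)"
        by (auto intro!: derivative_eq_intros)
      ultimately have "((\<lambda>x. A t (t * x)) has_real_derivative - G t 0 * t) (at 0)"
        by (rule DERIV_chain2)
      hence "((\<lambda>h. (A t (t * h) - A t 0) / h) \<longlongrightarrow> - G t 0 * t) (at 0)"
        by (simp add: DERIV_def)
      moreover have "filterlim a (at 0) sequentially"
        using a_lim a(1) by (auto simp: filterlim_at intro!: always_eventually) (metis less_irrefl)
      ultimately have "(\<lambda>n. (A t (t * a n) - A t 0) / a n) \<longlonglongrightarrow> - G t 0 * t"
        by (rule filterlim_compose)
      hence "(\<lambda>n. - (t ^ k) * ((A t (t * a n) - A t 0) / a n)) \<longlonglongrightarrow> - (t ^ k) * (- G t 0 * t)"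
        by (intro tendsto_mult_left)
      moreover have "- (t ^ k) * ((A t (t * a n) - A t 0) / a n) = S n t" for n
        by (simp add: S_def algebra_simps diff_divide_distrib)
      ultimately show ?case by (simp add: algebra_simps)
    qed
  qed
  have "(LINT t|lborel. S n t) = 0" for n
  proof -
    have "(LINT t|lborel. S n t) = (LINT t|lborel. t ^ k * A t (t * 0)) / a n - (LINT t|lborel. t ^ k * A t (t * a n)) / a n"
      unfolding S_def using A_int[of 0] A_int[of "a n"] by simp
    thus ?thesis using fub[of 0] fub[of "a n"] a[of n] \<open>0 < \<epsilon>\<close> by simp
  qed
  thus ?thesis using lim LIMSEQ_unique[OF _ tendsto_const] by simp
qed

text \<open>The induction on \<open>k\<close> runs over all lines at once, because order k + 1 on
  one line uses order k on its tilted and shifted neighbours in the plane of \<open>v\<close> and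
  \<open>n\<close>. The normal \<open>n\<close> points away from \<open>K\<close>; it records the
  side on which every translate still misses \<open>K\<close>.\<close>

lemma line_moments_vanish:
  fixes g :: "'a::euclidean_space \<Rightarrow> real"
  assumes K: "compact K"
    and g[measurable]: "g \<in> borel_measurable borel" and B: "\<And>x. \<bar>g x\<bar> \<le> B" and supp: "bounded {x. g x \<noteq> 0}"
    and cont: "\<And>p v. v \<noteq> 0 \<Longrightarrow> (\<And>t. p + t *\<^sub>R v \<notin> K) \<Longrightarrow> AE t in lborel. isCont g (p + t *\<^sub>R v)"
    and zero: "\<And>p v. v \<noteq> 0 \<Longrightarrow> (\<And>t. p + t *\<^sub>R v \<notin> K) \<Longrightarrow> (LINT t|lborel. g (p + t *\<^sub>R v)) = 0"
    and line: "v \<noteq> 0" "n \<noteq> 0" "n \<bullet> v = 0" "\<And>z. z \<in> K \<Longrightarrow> n \<bullet> (z - p) < 0"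
  shows "(LINT t|lborel. t ^ k * g (p + t *\<^sub>R v)) = 0"
  using line
proof (induction k arbitrary: p v n)
  case 0
  have "p + t *\<^sub>R v \<notin> K" for t
    using "0.prems"(3) "0.prems"(4)[of "p + t *\<^sub>R v"] by auto
  thus ?case using zero[OF "0.prems"(1)] by simp
next
  case (Suc k)
  note prems = Suc.prems
  have vv: "0 < v \<bullet> v" and nn: "0 < n \<bullet> n" and vn: "v \<bullet> n = 0"
    using prems by (auto simp: inner_commute)
  have miss: "p + t *\<^sub>R v \<notin> K" for t
    using prems(3) prems(4)[of "p + t *\<^sub>R v"] by auto
  obtain M where M: "\<And>x. g x \<noteq> 0 \<Longrightarrow> norm x \<le> M"
    using supp by (auto simp: bounded_iff)
  define G where "G t s = g (p + t *\<^sub>R v + s *\<^sub>R n)" for t s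
  define T where "T = max ((M + norm p) / norm v) ((M + norm p) / norm n)"
  \<comment> \<open>As \<open>v\<close> and \<open>n\<close> are orthogonal, the inner product with
    either of them isolates its coordinate, and Cauchy-Schwarz bounds that by the size of the
    support of \<open>g\<close>.\<close>
  have coord: "\<bar>c\<bar> \<le> (M + norm p) / norm w" if "g x \<noteq> 0" "w \<noteq> 0" "w \<bullet> (x - p) = c * (w \<bullet> w)" for c w x
  proof -
    have "\<bar>c\<bar> * (norm w * norm w) = \<bar>w \<bullet> (x - p)\<bar>"
      using that(3) by (simp add: abs_mult power2_eq_square[symmetric] power2_norm_eq_inner)
    also have "\<dots> \<le> norm w * norm (x - p)" by (rule Cauchy_Schwarz_ineq2)
    also have "\<dots> \<le> norm w * (M + norm p)"
      using M[OF that(1)] norm_triangle_ineq4[of x p] by (intro mult_left_mono) auto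
    finally have "norm w * (\<bar>c\<bar> * norm w) \<le> norm w * (M + norm p)" by (simp add: mult_ac)
    hence "\<bar>c\<bar> * norm w \<le> M + norm p"
      by (rule mult_left_le_imp_le) (use that(2) in simp)
    thus ?thesis using that(2) by (simp add: pos_le_divide_eq)
  qed
  have G_supp: "\<bar>t\<bar> \<le> T \<and> \<bar>s\<bar> \<le> T" if "G t s \<noteq> 0" for t s
    using coord[of "p + t *\<^sub>R v + s *\<^sub>R n" v t] coord[of "p + t *\<^sub>R v + s *\<^sub>R n" n s] that prems vn
    unfolding G_def T_def by (auto simp: inner_simps max.coboundedI1 max.coboundedI2)
  \<comment> \<open>Compactness of \<open>K\<close> turns strict separation into a uniform gap,
    which is the room for tilting.\<close>
  obtain \<delta> where \<delta>: "0 < \<delta>" "\<And>z. z \<in> K \<Longrightarrow> n \<bullet> (z - p) \<le> - \<delta>"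
  proof (cases "K = {}")
    case True
    thus ?thesis using that[of 1] by auto
  next
    case False
    have "continuous_on K (\<lambda>z. n \<bullet> (z - p))" by (intro continuous_intros)
    then obtain y where "y \<in> K" "\<And>z. z \<in> K \<Longrightarrow> n \<bullet> (z - p) \<le> n \<bullet> (y - p)"
      using continuous_attains_sup[OF K False] by blast
    thus ?thesis using prems(4)[of y] that[of "- (n \<bullet> (y - p))"] by auto
  qed
  obtain C where C: "0 < C" "\<And>z. z \<in> K \<Longrightarrow> \<bar>v \<bullet> (z - p)\<bar> \<le> C"
  proof -
    have "compact ((\<lambda>z. v \<bullet> (z - p)) ` K)"
      by (intro compact_continuous_image K continuous_intros)
    thus ?thesis using that compact_imp_bounded bounded_pos[of "(\<lambda>z. v \<bullet> (z - p)) ` K"] by auto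
  qed
  \<comment> \<open>For slopes below \<open>\<epsilon>\<close>, tilting \<open>n\<close> along with \<open>v\<close> keeps \<open>K\<close> strictly on the negative side.\<close>
  define \<epsilon> where "\<epsilon> = \<delta> * (v \<bullet> v) / ((n \<bullet> n) * C)"
  have \<epsilon>: "0 < \<epsilon>" using \<delta> vv nn C by (simp add: \<epsilon>_def)
  have pert: "(LINT t|lborel. t ^ k * G t (b + t * a)) = 0" if ab: "0 \<le> a" "a < \<epsilon>" "0 \<le> b" for a b
  proof -
    \<comment> \<open>Chosen so that n - c v is orthogonal to the tilted direction v + a n. The tilt
      changes the inner product with z - p by at most c C, and \<open>a < \<epsilon>\<close> says
      exactly that this is below the gap \<open>\<delta>\<close>; the shift by b n only moves the
      line further from \<open>K\<close>.\<close>
    define c where "c = a * (n \<bullet> n) / (v \<bullet> v)"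
    have c: "c * (v \<bullet> v) = a * (n \<bullet> n)" "0 \<le> c" "c * C < \<delta>"
      using ab vv nn C by (auto simp: c_def \<epsilon>_def field_simps)
    have "(LINT t|lborel. t ^ k * g ((p + b *\<^sub>R n) + t *\<^sub>R (v + a *\<^sub>R n))) = 0"
    proof (rule Suc.IH[of _ "n - c *\<^sub>R v"])
      have "v \<bullet> (v + a *\<^sub>R n) \<noteq> 0" using vv vn by (simp add: inner_simps)
      thus "v + a *\<^sub>R n \<noteq> 0" by auto
      have "n \<bullet> (n - c *\<^sub>R v) \<noteq> 0" using nn prems(3) by (simp add: inner_simps)
      thus "n - c *\<^sub>R v \<noteq> 0" by auto
      show "(n - c *\<^sub>R v) \<bullet> (v + a *\<^sub>R n) = 0"
        using c(1) vn prems(3) by (simp add: inner_simps)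
    next
      fix z assume z: "z \<in> K"
      have "(n - c *\<^sub>R v) \<bullet> (z - (p + b *\<^sub>R n)) = n \<bullet> (z - p) - b * (n \<bullet> n) - c * (v \<bullet> (z - p))"
        using vn by (simp add: inner_simps algebra_simps)
      moreover have "n \<bullet> (z - p) \<le> - \<delta>" using \<delta> z by auto
      moreover have "0 \<le> b * (n \<bullet> n)" using ab by simp
      moreover have "- (c * (v \<bullet> (z - p))) \<le> c * C"
        using mult_left_mono[OF _ c(2), of "- (v \<bullet> (z - p))" C] C(2)[OF z] by (simp add: abs_le_iff)
      ultimately show "(n - c *\<^sub>R v) \<bullet> (z - (p + b *\<^sub>R n)) < 0" using c(3) by linarith
    qed
    thus ?thesis by (simp add: G_def algebra_simps)
  qed
  have "AE t in lborel. isCont (G t) 0"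
    using cont[OF prems(1) miss]
  proof eventually_elim
    case (elim t)
    have "isCont (\<lambda>s. p + t *\<^sub>R v + s *\<^sub>R n) 0" by (intro continuous_intros)
    from isCont_o2[OF this] show ?case using elim by (simp add: G_def[abs_def])
  qed
  moreover have "case_prod G \<in> borel_measurable borel"
  proof -
    have "(\<lambda>x::real \<times> real. p + fst x *\<^sub>R v + snd x *\<^sub>R n) \<in> borel_measurable borel"
      by (intro borel_measurable_continuous_onI continuous_intros)
    from measurable_compose[OF this g] show ?thesis by (simp add: G_def case_prod_beta')
  qed
  ultimately have "(LINT t|lborel. t ^ Suc k * G t 0) = 0"
    using moment_step_plane[of G B T \<epsilon> k] B G_supp \<epsilon> pert by (auto simp: G_def)
  thus ?case by (simp add: G_def)
qed

section \<open>The moment problem on an interval\<close>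

text \<open>\<open>h\<close> is orthogonal to every polynomial and, by Weierstrass, a uniform limit
  of polynomials. Hence it is orthogonal to itself.\<close>

lemma moments_zero_imp_zero:
  fixes h :: "real \<Rightarrow> real"
  assumes "a < b" and cont: "continuous_on {a..b} h"
    and mom: "\<And>k. integral {a..b} (\<lambda>t. t ^ k * h t) = 0"
    and t: "t \<in> {a..b}"
  shows "h t = 0"
proof -
  have poly: "integral {a..b} (\<lambda>t. q t * h t) = 0" if qp: "real_polynomial_function q" for q
  proof -
    obtain c n where q: "q = (\<lambda>x. \<Sum>i\<le>n. c i * x ^ i)"
      using qp[unfolded real_polynomial_function_iff_sum] by blast
    have "integral {a..b} (\<lambda>t. q t * h t) = integral {a..b} (\<lambda>t. \<Sum>i\<le>n. c i * (t ^ i * h t))"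
      by (simp only: q sum_distrib_right mult.assoc)
    also have "\<dots> = (\<Sum>i\<le>n. integral {a..b} (\<lambda>t. c i * (t ^ i * h t)))"
      by (intro integral_sum integrable_continuous_interval continuous_intros cont) auto
    also have "\<dots> = 0" using mom by simp
    finally show ?thesis .
  qed
  obtain M where M: "0 < M" "\<And>t. t \<in> {a..b} \<Longrightarrow> \<bar>h t\<bar> \<le> M"
    using compact_imp_bounded[OF compact_continuous_image[OF cont compact_Icc]]
    by (auto simp: bounded_pos)
  have "\<bar>integral {a..b} (\<lambda>t. h t * h t)\<bar> \<le> 0 + e" if "0 < e" for e
  proof -
    \<comment> \<open>The error bound d M (b - a) for the integral of (h - q) h then equals
      \<open>e\<close>.\<close>
    define d where "d = e / (M * (b - a))"
    have d: "0 < d" using that M \<open>a < b\<close> by (simp add: d_def)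
    obtain q where q: "real_polynomial_function q" "\<And>x. x \<in> {a..b} \<Longrightarrow> \<bar>h x - q x\<bar> < d"
      using Stone_Weierstrass_real_polynomial_function[OF compact_Icc cont d] by blast
    have qc: "continuous_on {a..b} q"
      using q(1) by (intro continuous_at_imp_continuous_on ballI continuous_real_polymonial_function)
    have "integral {a..b} (\<lambda>t. h t * h t) = integral {a..b} (\<lambda>t. h t * h t) - integral {a..b} (\<lambda>t. q t * h t)"
      using poly[OF q(1)] by simp
    also have "\<dots> = integral {a..b} (\<lambda>t. h t * h t - q t * h t)"
      by (intro integral_diff[symmetric] integrable_continuous_interval continuous_intros cont qc)
    finally have "norm (integral {a..b} (\<lambda>t. h t * h t)) = norm (integral {a..b} (\<lambda>t. h t * h t - q t * h t))" by simp
    also have "\<dots> \<le> d * M * (b - a)"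
    proof (rule integral_bound)
      fix t assume "t \<in> {a..b}"
      hence "\<bar>h t - q t\<bar> * \<bar>h t\<bar> \<le> d * M" using M q(2)[of t] d by (intro mult_mono) auto
      thus "norm (h t * h t - q t * h t) \<le> d * M"
        by (simp add: left_diff_distrib[symmetric] abs_mult)
    qed (use \<open>a < b\<close> in \<open>auto intro!: continuous_intros cont qc\<close>)
    also have "\<dots> = e" using M \<open>a < b\<close> by (simp add: d_def)
    finally show ?thesis by simp
  qed
  hence "\<bar>integral {a..b} (\<lambda>t. h t * h t)\<bar> \<le> 0" by (rule field_le_epsilon)
  hence "integral {a..b} (\<lambda>t. h t * h t) = 0" by simp
  moreover have "continuous_on {a..b} (\<lambda>t. h t * h t)" by (intro continuous_intros cont)
  ultimately have "\<forall>t\<in>{a..b}. h t * h t = 0"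
    using integral_eq_0_iff[of a b "\<lambda>t. h t * h t"] \<open>a < b\<close> by simp
  thus ?thesis using t by simp
qed

section \<open>Lines through strictly convex sets\<close>

lemma strictly_convex_imp_convex_closure:
  assumes "strictly_convex S"
  shows "convex (closure S)"
  unfolding convex_contains_open_segment
proof (intro ballI)
  fix x y assume "x \<in> closure S" "y \<in> closure S"
  hence "x = y \<or> open_segment x y \<subseteq> interior S"
    using assms by (auto simp: strictly_convex_def)
  thus "open_segment x y \<subseteq> closure S"
    using interior_subset[of S] closure_subset[of S] by auto
qed

lemma strictly_convex_line_between:
  assumes "strictly_convex D" "v \<noteq> 0" "p + a *\<^sub>R v \<in> closure D" "p + b *\<^sub>R v \<in> closure D" "a < t" "t < b"
  shows "p + t *\<^sub>R v \<in> interior D"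
proof -
  define u where "u = (t - a) / (b - a)"
  have u: "0 < u" "u < 1" and "u * (b - a) = t - a"
    using assms(5,6) by (auto simp: u_def)
  hence t: "t = (1 - u) * a + u * b" by (simp add: algebra_simps)
  have "p + t *\<^sub>R v = (1 - u) *\<^sub>R (p + a *\<^sub>R v) + u *\<^sub>R (p + b *\<^sub>R v)"
    by (simp add: t algebra_simps)
  moreover have "p + a *\<^sub>R v \<noteq> p + b *\<^sub>R v" using assms(2,5,6) by auto
  ultimately show ?thesis
    using assms(1,3,4) u by (force simp: strictly_convex_def in_segment)
qed

text \<open>Of three boundary points on a line the middle one would be interior. Finiteness makes
  the jumps of the zero extension a null set on each line.\<close>

lemma strictly_convex_line_frontier_finite:
  assumes "strictly_convex D" "v \<noteq> 0"
  shows "finite {t. p + t *\<^sub>R v \<in> frontier D}"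
proof (rule ccontr)
  let ?S = "{t. p + t *\<^sub>R v \<in> frontier D}"
  have no: False if "x \<in> ?S" "y \<in> ?S" "z \<in> ?S" "x < y" "y < z" for x y z
    using strictly_convex_line_between[OF assms, of p x z y] that by (auto simp: frontier_def)
  assume "infinite ?S"
  then obtain T where "T \<subseteq> ?S" "card T = 3"
    using infinite_arbitrarily_large by blast
  then obtain x y z where "x \<in> ?S" "y \<in> ?S" "z \<in> ?S" "x \<noteq> y" "y \<noteq> z" "x \<noteq> z"
    by (auto simp: card_3_iff)
  thus False
    using no[of x y z] no[of x z y] no[of y x z] no[of y z x] no[of z x y] no[of z y x] by linarith
qed

text \<open>\<open>a\<close> and \<open>b\<close> are the extreme parameters of the compact set
  where the line meets \<open>closure D\<close>. Openness puts points of \<open>D\<close> strictly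
  between them; strict convexity puts everything strictly between them into
  \<open>D\<close>.\<close>

lemma strictly_convex_chord:
  fixes D :: "'a::euclidean_space set"
  assumes D: "open D" "bounded D" "strictly_convex D" and "v \<noteq> 0" and p: "p \<in> D"
  obtains a b where "a < 0" "0 < b" "\<And>t. p + t *\<^sub>R v \<in> D \<longleftrightarrow> a < t \<and> t < b"
    "p + a *\<^sub>R v \<in> frontier D" "p + b *\<^sub>R v \<in> frontier D"
proof -
  define S where "S = {t. p + t *\<^sub>R v \<in> closure D}"
  have cont: "continuous_on UNIV (\<lambda>t. p + t *\<^sub>R v)" by (intro continuous_intros)
  have "closed S"
    using continuous_closed_vimage[of "closure D" "\<lambda>t. p + t *\<^sub>R v"] by (simp add: S_def vimage_def)
  moreover have "bounded S"
  proof -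
    obtain M where M: "\<And>x. x \<in> closure D \<Longrightarrow> norm x \<le> M"
      using bounded_closure[OF D(2)] by (auto simp: bounded_iff)
    have "\<bar>t\<bar> \<le> (M + norm p) / norm v" if "t \<in> S" for t
    proof -
      have "\<bar>t\<bar> * norm v = norm ((p + t *\<^sub>R v) - p)" by simp
      also have "\<dots> \<le> norm (p + t *\<^sub>R v) + norm p" by (rule norm_triangle_ineq4)
      also have "\<dots> \<le> M + norm p" using M that by (simp add: S_def)
      finally show ?thesis using \<open>v \<noteq> 0\<close> by (simp add: pos_le_divide_eq)
    qed
    thus ?thesis by (auto simp: bounded_iff)
  qed
  ultimately have S: "compact S" by (simp add: compact_eq_bounded_closed)
  have S0: "0 \<in> S" using p closure_subset by (auto simp: S_def)
  obtain a where a: "a \<in> S" "\<And>t. t \<in> S \<Longrightarrow> a \<le> t"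
    using compact_attains_inf[OF S] S0 by blast
  obtain b where b: "b \<in> S" "\<And>t. t \<in> S \<Longrightarrow> t \<le> b"
    using compact_attains_sup[OF S] S0 by blast
  have nbd: "\<exists>e>0. \<forall>s. \<bar>s - t\<bar> < e \<longrightarrow> s \<in> S" if tD: "p + t *\<^sub>R v \<in> D" for t
  proof -
    have op: "open ((\<lambda>t. p + t *\<^sub>R v) -` D)"
      by (intro open_vimage D continuous_intros)
    obtain e where e: "0 < e" "ball t e \<subseteq> (\<lambda>t. p + t *\<^sub>R v) -` D"
      using openE[OF op, of t] tD by auto
    have "s \<in> S" if "\<bar>s - t\<bar> < e" for s
    proof -
      have "s \<in> ball t e" using that by (simp add: dist_real_def abs_minus_commute)
      thus ?thesis using e(2) closure_subset[of D] by (auto simp: S_def)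
    qed
    thus ?thesis using e(1) by blast
  qed
  have strict: "a < t \<and> t < b" if "p + t *\<^sub>R v \<in> D" for t
  proof -
    obtain e where e: "e > 0" "\<And>s. \<bar>s - t\<bar> < e \<Longrightarrow> s \<in> S" using nbd[OF \<open>p + t *\<^sub>R v \<in> D\<close>] by blast
    hence "t - e/2 \<in> S" "t + e/2 \<in> S" by auto
    thus ?thesis using a(2)[of "t - e/2"] b(2)[of "t + e/2"] e(1) by auto
  qed
  have iff: "p + t *\<^sub>R v \<in> D \<longleftrightarrow> a < t \<and> t < b" for t
    using strict[of t] strictly_convex_line_between[OF D(3) \<open>v \<noteq> 0\<close>, of p a b t] a(1) b(1) interior_subset[of D]
    by (auto simp: S_def)
  show ?thesis
  proof (rule that[OF _ _ iff])
    show "a < 0" "0 < b" using strict[of 0] p by auto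
    show "p + a *\<^sub>R v \<in> frontier D" "p + b *\<^sub>R v \<in> frontier D"
      using a(1) b(1) iff[of a] iff[of b] D(1) by (auto simp: S_def frontier_def interior_open)
  qed
qed

section \<open>From broken rays to moments on lines\<close>

theorem mainTheorem2:
  fixes D Ob \<Omega> E R :: "(real^2) set" and f :: "real^2 \<Rightarrow> real"
  assumes "open D" and "connected D" and "bounded D"
    and "strictly_convex D" and "smooth_boundary D"
    and "Ob \<noteq> {}" and "open Ob"
    and "strictly_convex Ob" and "smooth_boundary Ob"
    and "closure Ob \<subseteq> D"
    and "\<Omega> = D - closure Ob"
    and "E = frontier D" and "R = frontier Ob"
    and "Ck_closure 2 \<Omega> f"
    and "broken_ray_transform_vanishes \<Omega> E R f"
  shows "\<forall>x\<in>closure \<Omega>. f x = 0"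
proof -
  let ?K = "closure Ob"
  note D = assms(1,3,4) and \<Omega>_eq = assms(11)
  have \<Omega>: "open \<Omega>" using D by (simp add: \<Omega>_eq open_Diff)
  have cont: "continuous_on (closure \<Omega>) f"
    using assms(14) by (simp add: Ck_closure_def numeral_2_eq_2)
  have cont\<Omega>: "continuous_on \<Omega> f"
    using cont closure_subset by (rule continuous_on_subset)
  have K: "compact ?K"
    using bounded_subset[OF assms(3,10)] by (simp add: compact_eq_bounded_closed)
  define g where "g x = indicator \<Omega> x * f x" for x
  have g_meas: "g \<in> borel_measurable borel"
    using borel_measurable_continuous_on_indicator[OF _ cont\<Omega>] \<Omega> by (simp add: g_def[abs_def])
  have "bounded (closure \<Omega>)"
    using bounded_closure[OF bounded_subset[OF assms(3), of \<Omega>]] by (auto simp: \<Omega>_eq)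
  hence "bounded (f ` closure \<Omega>)"
    by (intro compact_imp_bounded compact_continuous_image[OF cont]) (simp add: compact_eq_bounded_closed)
  then obtain B where B: "0 < B" "\<And>x. x \<in> closure \<Omega> \<Longrightarrow> \<bar>f x\<bar> \<le> B"
    by (auto simp: bounded_pos)
  have g_le: "\<bar>g x\<bar> \<le> B" for x
    using B closure_subset[of \<Omega>] by (auto simp: g_def indicator_def)
  have g_supp: "bounded {x. g x \<noteq> 0}"
    by (rule bounded_subset[OF assms(3)]) (auto simp: g_def \<Omega>_eq indicator_def)
  \<comment> \<open>Away from the obstacle, \<open>g\<close> is continuous both inside and outside
    \<open>D\<close>, so it can jump only across the outer boundary.\<close>
  have g_cont: "isCont g x" if "x \<notin> ?K" "x \<notin> frontier D" for x
  proof (cases "x \<in> D")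
    case True
    hence "x \<in> \<Omega>" using that by (simp add: \<Omega>_eq)
    moreover have "continuous_on \<Omega> g"
      using cont\<Omega> by (rule continuous_on_eq) (simp add: g_def)
    ultimately show ?thesis using \<Omega> continuous_on_eq_continuous_at by blast
  next
    case False
    hence "x \<in> - closure D" using that D by (simp add: frontier_def interior_open)
    moreover have "continuous_on (- closure D) g"
      using continuous_on_const[of "- closure D" "0::real"]
      by (rule continuous_on_eq) (use closure_subset in \<open>auto simp: g_def \<Omega>_eq indicator_def\<close>)
    ultimately show ?thesis using continuous_on_eq_continuous_at[of "- closure D" g] by auto
  qed
  have AE_cont: "AE t in lborel. isCont g (p + t *\<^sub>R v)"
    if "v \<noteq> 0" "\<And>t. p + t *\<^sub>R v \<notin> ?K" for p v
  proof (rule AE_I')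
    show "{t. p + t *\<^sub>R v \<in> frontier D} \<in> null_sets lborel"
      by (intro finite_imp_null_set_lborel strictly_convex_line_frontier_finite assms that)
    show "{t \<in> space lborel. \<not> isCont g (p + t *\<^sub>R v)} \<subseteq> {t. p + t *\<^sub>R v \<in> frontier D}"
      using g_cont that by auto
  qed
  \<comment> \<open>On the line, \<open>g\<close> and \<open>f\<close> cut off to [a,b] can differ
    only at the two ends, where \<open>g\<close> is 0 and \<open>f\<close> need not be. Order 0
    serves the ray transform, higher orders the moments.\<close>
  have chord: "(\<forall>t\<in>{a..b}. p + t *\<^sub>R v \<in> closure \<Omega>) \<and>
      (LINT t|lborel. t ^ k * g (p + t *\<^sub>R v)) = integral {a..b} (\<lambda>t. t ^ k * f (p + t *\<^sub>R v))"
    if ab: "a < b" and D_iff: "\<And>t. p + t *\<^sub>R v \<in> D \<longleftrightarrow> a < t \<and> t < b" and miss: "\<And>t. p + t *\<^sub>R v \<notin> ?K"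
    for a b p v and k :: nat
  proof -
    have "(\<lambda>t. p + t *\<^sub>R v) ` closure {a<..<b} \<subseteq> closure \<Omega>"
    proof (rule image_closure_subset)
      show "(\<lambda>t. p + t *\<^sub>R v) ` {a<..<b} \<subseteq> closure \<Omega>"
        using D_iff miss closure_subset[of \<Omega>] by (auto simp: \<Omega>_eq)
    qed (auto intro!: continuous_intros)
    hence cl: "p + t *\<^sub>R v \<in> closure \<Omega>" if "t \<in> {a..b}" for t
      using ab that by (auto simp: image_subset_iff)
    have hc: "continuous_on {a..b} (\<lambda>t. t ^ k * f (p + t *\<^sub>R v))"
      using cl by (intro continuous_intros continuous_on_compose2[OF cont]) auto
    have int: "set_integrable lborel {a..b} (\<lambda>t. t ^ k * f (p + t *\<^sub>R v))"
      using borel_integrable_compact[OF compact_Icc hc] by (simp add: set_integrable_def)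
    have g_eq: "t ^ k * g (p + t *\<^sub>R v) = indicator {a..b} t * (t ^ k * f (p + t *\<^sub>R v))"
      if "t \<notin> {a, b}" for t
      using that D_iff[of t] miss[of t] by (auto simp: g_def \<Omega>_eq indicator_def)
    have "(LINT t|lborel. t ^ k * g (p + t *\<^sub>R v)) = (LINT t|lborel. indicator {a..b} t * (t ^ k * f (p + t *\<^sub>R v)))"
    proof (rule integral_cong_AE)
      have "(\<lambda>t. p + t *\<^sub>R v) \<in> borel_measurable borel"
        by (intro borel_measurable_continuous_onI continuous_intros)
      from measurable_compose[OF this g_meas]
      show "(\<lambda>t. t ^ k * g (p + t *\<^sub>R v)) \<in> borel_measurable lborel" by simp
      show "(\<lambda>t. indicator {a..b} t * (t ^ k * f (p + t *\<^sub>R v))) \<in> borel_measurable lborel"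
        using borel_measurable_integrable int by (simp add: set_integrable_def)
      show "AE t in lborel. t ^ k * g (p + t *\<^sub>R v) = indicator {a..b} t * (t ^ k * f (p + t *\<^sub>R v))"
        by (rule AE_I'[OF finite_imp_null_set_lborel[of "{a, b}"]]) (use g_eq in auto)
    qed
    also have "\<dots> = integral {a..b} (\<lambda>t. t ^ k * f (p + t *\<^sub>R v))"
      using set_borel_integral_eq_integral(2)[OF int] by (simp add: set_lebesgue_integral_def)
    finally show ?thesis using cl by blast
  qed
  have line_zero: "(LINT t|lborel. g (p + t *\<^sub>R v)) = 0"
    if "v \<noteq> 0" and miss: "\<And>t. p + t *\<^sub>R v \<notin> ?K" for p v
  proof (cases "\<exists>t. p + t *\<^sub>R v \<in> D")
    case False
    hence "g (p + t *\<^sub>R v) = 0" for t by (auto simp: g_def \<Omega>_eq)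
    thus ?thesis by simp
  next
    case True
    then obtain t0 where t0: "p + t0 *\<^sub>R v \<in> D" by blast
    define c where "c = inverse (norm v)"
    define u where "u = c *\<^sub>R v"
    have c: "0 < c" and u: "norm u = 1" "u \<noteq> 0"
      using \<open>v \<noteq> 0\<close> by (auto simp: c_def u_def)
    obtain a b where ab: "a < 0" "0 < b" "\<And>t. (p + t0 *\<^sub>R v) + t *\<^sub>R u \<in> D \<longleftrightarrow> a < t \<and> t < b"
      "(p + t0 *\<^sub>R v) + a *\<^sub>R u \<in> frontier D" "(p + t0 *\<^sub>R v) + b *\<^sub>R u \<in> frontier D"
      using strictly_convex_chord[OF D u(2) t0] by blast
    \<comment> \<open>The point where the line enters \<open>D\<close>, so that the unit speed chord
      is parametrized from 0 to \<open>L\<close>.\<close>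
    define q where "q = p + (t0 + a * c) *\<^sub>R v"
    define L where "L = b - a"
    have q: "q + t *\<^sub>R u = (p + t0 *\<^sub>R v) + (a + t) *\<^sub>R u" for t
      by (simp add: q_def u_def algebra_simps)
    have q': "q + t *\<^sub>R u = p + (t0 + a * c + c * t) *\<^sub>R v" for t
      by (simp add: q_def u_def algebra_simps)
    have L: "0 < L" using ab by (simp add: L_def)
    have q_iff: "q + t *\<^sub>R u \<in> D \<longleftrightarrow> 0 < t \<and> t < L" for t
      unfolding q ab(3) L_def by auto
    have q_miss: "q + t *\<^sub>R u \<notin> ?K" for t unfolding q' by (rule miss)
    note ch = chord[OF L q_iff q_miss]
    \<comment> \<open>The chord is a broken ray without reflections: it meets the boundary only at
      its two ends, where it starts and stops.\<close>
    have "broken_ray \<Omega> E R L (\<lambda>t. q + t *\<^sub>R u)"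
      unfolding broken_ray_def
    proof (intro conjI ballI impI)
      show "0 < L" by fact
      show "continuous_on {0..L} (\<lambda>t. q + t *\<^sub>R u)" by (intro continuous_intros)
      show "(\<lambda>t. q + t *\<^sub>R u) ` {0..L} \<subseteq> closure \<Omega>" using ch by auto
      show "q + 0 *\<^sub>R u \<in> E" unfolding q using ab(4) by (simp add: assms(12))
      show "q + L *\<^sub>R u \<in> E" unfolding q L_def using ab(5) by (simp add: assms(12))
      have inside: "q + t *\<^sub>R u \<in> \<Omega>" if "0 < t" "t < L" for t
        using q_iff[of t] q_miss[of t] that by (simp add: \<Omega>_eq)
      have "{t \<in> {0..L}. q + t *\<^sub>R u \<in> frontier \<Omega>} \<subseteq> {0, L}"
      proof
        fix t assume "t \<in> {t \<in> {0..L}. q + t *\<^sub>R u \<in> frontier \<Omega>}"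
        thus "t \<in> {0, L}" using inside[of t] \<Omega> by (cases "t = 0 \<or> t = L") (auto simp: frontier_def interior_open)
      qed
      thus "finite {t \<in> {0..L}. q + t *\<^sub>R u \<in> frontier \<Omega>}" by (rule finite_subset) simp
      show "straight_at L (\<lambda>t. q + t *\<^sub>R u) t" for t
        unfolding straight_at_def
        by (intro exI[of _ u] exI[of _ 1]) (auto simp: u algebra_simps)
      show "reflects_at \<Omega> L (\<lambda>t. q + t *\<^sub>R u) t" if "t \<in> {0<..<L}" "q + t *\<^sub>R u \<in> E \<union> R" for t
      proof -
        have "q + t *\<^sub>R u \<notin> E"
          using q_iff[of t] that(1) D by (auto simp: assms(12) frontier_def interior_open)
        moreover have "q + t *\<^sub>R u \<notin> R"
          using q_miss[of t] by (simp add: assms(13) frontier_def)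
        ultimately show ?thesis using that(2) by simp
      qed
    qed
    hence "integral {0..L} (\<lambda>t. f (q + t *\<^sub>R u)) = 0"
      using assms(15) by (simp add: broken_ray_transform_vanishes_def broken_ray_transform_def)
    hence "(LINT t|lborel. g (q + t *\<^sub>R u)) = 0"
      using ch[of 0] by simp
    \<comment> \<open>Undo the normalization of the speed by an affine substitution.\<close>
    moreover have "(LINT t|lborel. g (p + t *\<^sub>R v)) = \<bar>c\<bar> *\<^sub>R (LINT t|lborel. g (q + t *\<^sub>R u))"
      unfolding q' using c by (intro lborel_integral_real_affine) auto
    ultimately show ?thesis by simp
  qed
  have "f x = 0" if x: "x \<in> \<Omega>" for x
  proof -
    have xK: "x \<notin> ?K" and xD: "x \<in> D" using x by (auto simp: \<Omega>_eq)
    obtain n d where nd: "n \<bullet> x < d" "\<And>z. z \<in> ?K \<Longrightarrow> d < n \<bullet> z"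
      using separating_hyperplane_closed_point[OF strictly_convex_imp_convex_closure[OF assms(8)] closed_closure xK]
      by blast
    have n: "n \<noteq> 0"
    proof
      assume "n = 0"
      moreover obtain z where "z \<in> ?K" using assms(6) closure_subset by blast
      ultimately show False using nd(1) nd(2)[of z] by simp
    qed
    \<comment> \<open>A quarter turn of \<open>n\<close>: the line through \<open>x\<close> is
      parallel to the separating line. As \<open>n\<close> points towards the obstacle, the normal
      handed to \<open>line_moments_vanish\<close> is \<open>- n\<close>.\<close>
    define v :: "real^2" where "v = vector [- (n $ 2), n $ 1]"
    have nv: "n \<bullet> v = 0" by (simp add: v_def inner_vec_def sum_2)
    have v: "v \<noteq> 0" using n by (auto simp: v_def vec_eq_iff forall_2)
    have side: "- n \<bullet> (z - x) < 0" if "z \<in> ?K" for z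
      using nd(1) nd(2)[OF that] by (simp add: inner_diff_right)
    have miss: "x + t *\<^sub>R v \<notin> ?K" for t
      using side[of "x + t *\<^sub>R v"] nv by auto
    obtain a b where ab: "a < 0" "0 < b" "\<And>t. x + t *\<^sub>R v \<in> D \<longleftrightarrow> a < t \<and> t < b"
      using strictly_convex_chord[OF D v xD] by blast
    have "a < b" using ab by simp
    note ch = chord[OF this ab(3) miss]
    have mom: "integral {a..b} (\<lambda>t. t ^ k * f (x + t *\<^sub>R v)) = 0" for k
    proof -
      have "(LINT t|lborel. t ^ k * g (x + t *\<^sub>R v)) = 0"
      proof (rule line_moments_vanish[OF K g_meas g_le g_supp, where n = "- n"])
        show "- n \<noteq> 0" "- n \<bullet> v = 0" using n nv by auto
      qed (fact AE_cont line_zero v side)+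
      thus ?thesis using ch by simp
    qed
    have "continuous_on {a..b} (\<lambda>t. f (x + t *\<^sub>R v))"
      using ch by (intro continuous_on_compose2[OF cont] continuous_intros) auto
    \<comment> \<open>The parameter 0 is the point \<open>x\<close> itself and lies in the
      chord.\<close>
    from moments_zero_imp_zero[OF \<open>a < b\<close> this mom, of 0] ab show ?thesis by simp
  qed
  thus ?thesis
    using continuous_constant_on_closure[OF cont, of 0] by blast
qed

end
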